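(* Let $p$ be a positive integer and let $M_0,\dots,M_{p-1}>1$. Let $$F(z)=\sum_{k=0}^{p-1}\bar z^{k}A_k(z)$$ be a poly-analytic function of order $p$ in $U$, where all $A_k$ are analytic in $U$ and satisfy $A_k(0)=0$, $A_k'(0)=1$ and $|A_k(z)|\le M_k$ for all $z\in U$ and all $k\in\{0,1,\dots,p-1\}$. Then $F$ is univalent in $U_{\rho_3}$ and $F(U_{\rho_3})$ contains the schlicht disk $U_{\sigma_3}$, where $\rho_3$ is the unique root in $(0,1)$ of the equation $$1-\sum_{k=0}^{p-1}\Big(M_k-\frac1{M_k}\Big)\frac{r^{k+1}\big(2-r+k(1-r)\big)}{(1-r)^2}-\sum_{k=1}^{p-1}(k+1)r^k=0,$$ and $$\sigma_3=\rho_3-\rho_3^2\Big(\frac{1-\rho_3^{p-1}}{1-\rho_3}\Big)-\sum_{k=0}^{p-1}\Big(M_k-\frac1{M_k}\Big)\frac{\rho_3^{k+2}}{1-\rho_3}.$$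
   Context: For $r>0$, $U_r=\{z\in\mathbb C:|z|<r\}$ and $U=U_1$. A continuous function $F:D\to\mathbb C$ on a domain $D\subset\mathbb C$ is poly-analytic of order $p$ if $\partial^pF/\partial\bar z^p=0$ in $D$; in a simply connected domain this is equivalent to $F=\sum_{k=0}^{p-1}\bar z^kA_k(z)$ with all $A_k$ analytic. Univalent means injective. A schlicht disk in $F(U_\rho)$ is a disk that is the univalent image under $F$ of some region in $U_\rho$. Empty sums (when $p=1$) are $0$. *)

theory Defs
  imports "HOL-Complex_Analysis.Complex_Analysis"
begin

text \<open>The Wirtinger derivative with respect to the conjugate variable,
  \<open>(f\<^sub>x + \<i> f\<^sub>y) / 2\<close>; \<^const>\<open>frechet_derivative\<close> is taken over the reals.\<close>

definition dbar :: "(complex \<Rightarrow> complex) \<Rightarrow> complex \<Rightarrow> complex"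
  where "dbar f z = (frechet_derivative f (at z) 1 + \<i> * frechet_derivative f (at z) \<i>) / 2"

text \<open>The differentiability clause says that the iterated derivatives exist, since
  \<^const>\<open>frechet_derivative\<close> is a total function.\<close>

definition poly_analytic_on :: "nat \<Rightarrow> (complex \<Rightarrow> complex) \<Rightarrow> complex set \<Rightarrow> bool"
  where "poly_analytic_on p F D \<longleftrightarrow>
    continuous_on D F \<and>
    (\<forall>j<p. \<forall>z\<in>D. (dbar ^^ j) F differentiable (at z)) \<and>
    (\<forall>z\<in>D. (dbar ^^ p) F z = 0)"

definition schlicht_disk_in :: "(complex \<Rightarrow> complex) \<Rightarrow> complex set \<Rightarrow> complex \<Rightarrow> real \<Rightarrow> bool"
  where "schlicht_disk_in F D c s \<longleftrightarrow>
    0 < s \<and> (\<exists>\<Omega>\<subseteq>D. open \<Omega> \<and> connected \<Omega> \<and> inj_on F \<Omega> \<and> F ` \<Omega> = ball c s)"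

lemma has_derivative_cnj_sum:
  assumes D: "open D" "z \<in> D" and A: "\<And>k. k < p \<Longrightarrow> A k holomorphic_on D"
    and F: "\<And>z. z \<in> D \<Longrightarrow> F z = (\<Sum>k<p. cnj z ^ k * A k z)"
  shows "(F has_derivative
     (\<lambda>h. \<Sum>k<p. cnj z ^ k * (deriv (A k) z * h) + of_nat k * cnj h * cnj z ^ (k - 1) * A k z)) (at z)"
proof -
  have A': "(A k has_derivative (\<lambda>h. deriv (A k) z * h)) (at z)" if "k < p" for k
    using holomorphic_derivI[OF A[OF that] D(1,2)] by (simp add: has_field_derivative_def)
  have "((\<lambda>z. \<Sum>k<p. cnj z ^ k * A k z) has_derivative
     (\<lambda>h. \<Sum>k<p. cnj z ^ k * (deriv (A k) z * h) + of_nat k * cnj h * cnj z ^ (k - 1) * A k z)) (at z)"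
    by (rule has_derivative_sum has_derivative_mult has_derivative_power
        bounded_linear_imp_has_derivative bounded_linear_cnj A' | simp)+
  then show ?thesis
    using D by (rule has_derivative_transform_within_open) (simp add: F)
qed

lemma dbar_cnj_sum:
  assumes D: "open D" "z \<in> D" and A: "\<And>k. k < Suc p \<Longrightarrow> A k holomorphic_on D"
    and F: "\<And>z. z \<in> D \<Longrightarrow> F z = (\<Sum>k<Suc p. cnj z ^ k * A k z)"
  shows "dbar F z = (\<Sum>k<p. cnj z ^ k * (of_nat (Suc k) * A (Suc k) z))"
proof -
  have fd: "frechet_derivative F (at z) =
     (\<lambda>h. \<Sum>k<Suc p. cnj z ^ k * (deriv (A k) z * h) + of_nat k * cnj h * cnj z ^ (k - 1) * A k z)"
    by (rule frechet_derivative_at[OF has_derivative_cnj_sum[OF D A F], symmetric])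
  have "dbar F z = (\<Sum>k<Suc p. of_nat k * cnj z ^ (k - 1) * A k z)"
    unfolding dbar_def fd sum_distrib_left sum.distrib[symmetric] sum_divide_distrib
    by (rule sum.cong) (auto simp: algebra_simps)
  also have "\<dots> = (\<Sum>k<p. cnj z ^ k * (of_nat (Suc k) * A (Suc k) z))"
    unfolding sum.lessThan_Suc_shift by (simp add: mult_ac)
  finally show ?thesis .
qed

lemma poly_analytic_on_cnj_sum:
  assumes D: "open D" and A: "\<And>k. k < p \<Longrightarrow> A k holomorphic_on D"
    and F: "\<And>z. z \<in> D \<Longrightarrow> F z = (\<Sum>k<p. cnj z ^ k * A k z)"
  shows "poly_analytic_on p F D"
  using A F
proof (induction p arbitrary: A F)
  case 0
  then have "continuous_on D F \<longleftrightarrow> continuous_on D (\<lambda>_. 0::complex)"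
    by (intro continuous_on_cong) auto
  with 0 show ?case by (simp add: poly_analytic_on_def)
next
  case (Suc p)
  have diff: "F differentiable (at z)" if "z \<in> D" for z
    using has_derivative_cnj_sum[OF D that Suc.prems] by (auto simp: differentiable_def)
  have IH: "poly_analytic_on p (dbar F) D"
    by (rule Suc.IH[where A = "\<lambda>k z. of_nat (Suc k) * A (Suc k) z"])
       (auto intro!: holomorphic_intros Suc.prems(1) dbar_cnj_sum[OF D _ Suc.prems, simplified])
  have "continuous_on D F"
    using diff by (meson continuous_at_imp_continuous_on differentiable_imp_continuous_within)
  moreover have "(dbar ^^ j) F differentiable (at z)" if "j < Suc p" "z \<in> D" for j z
    using that diff IH by (cases j) (auto simp: poly_analytic_on_def funpow_swap1)
  moreover have "(dbar ^^ Suc p) F z = 0" if "z \<in> D" for z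
    using that IH by (simp add: poly_analytic_on_def funpow_swap1)
  ultimately show ?case by (simp add: poly_analytic_on_def)
qed

end

theory Submission imports Defs begin

text \<open>If \<open>A z = z + (\<Sum>n\<ge>2. a\<^sub>n z\<^sup>n)\<close> is bounded by \<open>M\<close>, then \<open>f z = A z / (M z)\<close> maps the disk into the closed unit
  disk and \<open>f 0 = 1 / M\<close>. Averaging \<open>f\<close> over the rotations by \<open>n\<close>-th roots of unity leaves
  \<open>f 0 + b\<^sub>n z\<^sup>n + \<dots>\<close>, and Schwarz--Pick for this average gives \<open>\<bar>b\<^sub>n\<bar> \<le> 1 - \<bar>f 0\<bar>\<^sup>2\<close>, that is,
  \<open>\<bar>a\<^sub>n\<bar> \<le> M - 1 / M\<close> for \<open>n \<ge> 2\<close>. Expanding \<open>F z - F w\<close> into the monomials \<open>cnj z ^ k * z ^ n\<close>, whose Lipschitz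
  constant on the disk of radius \<open>r\<close> is at most \<open>(k + n) r\<^bsup>k + n - 1\<^esup>\<close>, shows that \<open>F\<close> is injective as long as
  the perturbation of the leading term \<open>z - w\<close> has Lipschitz constant below 1, which is the root
  equation. The same expansion bounds \<open>\<bar>F\<bar>\<close> on the boundary circle from below by \<open>\<sigma>\<close>, and invariance of
  domain turns this into a covered disk.\<close>

section \<open>Coefficients of bounded power series\<close>

text \<open>On a circle of radius \<open>r\<close> below 1 the hypothesis bounds \<open>q\<close> by
  \<open>inverse r ^ n\<close>; the maximum modulus principle carries this inside, and
  \<open>r\<close> tends to 1. This is the Schwarz lemma with a zero of order at least
  \<open>n\<close> divided out.\<close>

lemma unit_disc_power_cancel:
  fixes q :: "complex \<Rightarrow> complex"
  assumes q: "q holomorphic_on ball 0 1"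
    and bound: "\<And>z. z \<in> ball 0 1 \<Longrightarrow> norm (z ^ n * q z) \<le> 1"
    and z: "z \<in> ball 0 1"
  shows "norm (q z) \<le> 1"
proof -
  have "norm (q z) \<le> inverse r ^ n" if r: "norm z < r" "r < 1" for r :: real
  proof (rule maximum_modulus_frontier[where S = "ball 0 r" and f = q and \<xi> = z])
    have r0: "0 < r" using r norm_ge_zero[of z] by linarith
    show "q holomorphic_on interior (ball 0 r)"
      using r by (auto intro: holomorphic_on_subset[OF q])
    show "continuous_on (closure (ball 0 r)) q"
      using r r0 by (intro holomorphic_on_imp_continuous_on holomorphic_on_subset[OF q]) auto
    show "bounded (ball (0::complex) r)" by simp
    show "z \<in> ball 0 r" using r by simp
    show "norm (q w) \<le> inverse r ^ n" if "w \<in> frontier (ball 0 r)" for w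
    proof -
      have w: "norm w = r" using that r0 by (simp add: frontier_ball)
      then show ?thesis
        using bound[of w] r r0 by (simp add: norm_mult norm_power field_simps)
    qed
  qed
  then have ev: "\<forall>\<^sub>F r in at_left 1. norm (q z) \<le> inverse r ^ n"
    using z by (intro eventually_at_leftI[of "norm z"]) auto
  have "((\<lambda>r::real. inverse r ^ n) \<longlongrightarrow> inverse 1 ^ n) (at_left 1)"
    by (intro tendsto_intros) auto
  from tendsto_lowerbound[OF this ev] show ?thesis by simp
qed

lemma powser_factor:
  fixes c :: "nat \<Rightarrow> complex"
  assumes sums: "\<And>z. z \<in> ball 0 1 \<Longrightarrow> (\<lambda>m. c m * z ^ m) sums g z"
    and zero: "\<And>m. m < n \<Longrightarrow> c m = 0"
  obtains k where "\<And>z. z \<in> ball 0 1 \<Longrightarrow> (\<lambda>m. c (m + n) * z ^ m) sums k z"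
    and "\<And>z. z \<in> ball 0 1 \<Longrightarrow> g z = z ^ n * k z"
proof -
  \<comment> \<open>At 0 the quotient takes its limit \<open>c n\<close>; for \<open>n > 0\<close>
    plain division would give 0 there.\<close>
  define k where "k z = (if z = 0 then c n else g z / z ^ n)" for z
  have shift: "(\<lambda>m. c (m + n) * z ^ (m + n)) sums g z" if "z \<in> ball 0 1" for z
    using sums[OF that] by (subst sums_zero_iff_shift) (auto simp: zero)
  have k: "(\<lambda>m. c (m + n) * z ^ m) sums k z" if "z \<in> ball 0 1" for z
  proof (cases "z = 0")
    case False
    have "(\<lambda>m. z ^ n * (c (m + n) * z ^ m)) sums (z ^ n * k z)"
      using shift[OF that] False by (simp add: k_def power_add mult_ac)
    with False show ?thesis by (subst (asm) sums_mult_iff) auto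
  qed (use powser_sums_zero[of "\<lambda>m. c (m + n)"] in \<open>simp add: k_def\<close>)
  moreover have "g z = z ^ n * k z" if "z \<in> ball 0 1" for z
  proof (rule sums_unique2[OF shift[OF that]])
    show "(\<lambda>m. c (m + n) * z ^ (m + n)) sums (z ^ n * k z)"
      using sums_mult[OF k[OF that], of "z ^ n"] by (simp add: power_add mult_ac)
  qed
  ultimately show ?thesis using that by blast
qed

lemma sum_roots_unity_power:
  assumes "0 < n"
  shows "(\<Sum>j<n. exp (2 * of_real pi * \<i> * of_nat m / of_nat n) ^ j) = (if n dvd m then of_nat n else 0)"
proof -
  define u where "u = exp (2 * of_real pi * \<i> * of_nat m / of_nat n)"
  have "u ^ n = 1"
    using assms by (simp add: u_def complex_root_unity)
  moreover have "u = 1 \<longleftrightarrow> n dvd m"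
    unfolding u_def using assms by (intro complex_root_unity_eq_1) simp
  ultimately show ?thesis
    by (auto simp: u_def[symmetric] sum_gp_strict)
qed

text \<open>Rotation by \<open>w ^ j\<close> multiplies the coefficient of index \<open>m\<close> by
  \<open>(w ^ m) ^ j\<close>. The mean over \<open>j\<close> of these factors is 1 or 0 according to
  \<open>n dvd m\<close>, and a mean of values of norm at most 1 keeps that bound.\<close>

lemma powser_dvd_part:
  fixes b :: "nat \<Rightarrow> complex"
  assumes sums: "\<And>z. z \<in> ball 0 1 \<Longrightarrow> (\<lambda>m. b m * z ^ m) sums f z"
    and bound: "\<And>z. z \<in> ball 0 1 \<Longrightarrow> norm (f z) \<le> 1"
    and n: "0 < n"
  obtains g where "\<And>z. z \<in> ball 0 1 \<Longrightarrow> (\<lambda>m. (if n dvd m then b m else 0) * z ^ m) sums g z"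
    and "\<And>z. z \<in> ball 0 1 \<Longrightarrow> norm (g z) \<le> 1"
proof -
  define w where "w = exp (2 * of_real pi * \<i> / of_nat n)"
  have nw: "norm w = 1" by (simp add: w_def norm_exp)
  have wm: "w ^ m = exp (2 * of_real pi * \<i> * of_nat m / of_nat n)" for m
    by (simp add: w_def exp_of_nat_mult[symmetric] mult_ac)
  define g where "g z = (\<Sum>j<n. f (w ^ j * z)) / of_nat n" for z
  have "norm (g z) \<le> 1" if "z \<in> ball 0 1" for z
  proof -
    have "norm (\<Sum>j<n. f (w ^ j * z)) \<le> of_nat (card {..<n}) * 1"
      by (rule sum_norm_bound) (use that nw in \<open>auto intro!: bound simp: norm_mult norm_power\<close>)
    then show ?thesis using n by (simp add: g_def norm_divide)
  qed
  moreover have "(\<lambda>m. (if n dvd m then b m else 0) * z ^ m) sums g z" if z: "z \<in> ball 0 1" for z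
  proof -
    have "(\<lambda>m. (\<Sum>j<n. b m * (w ^ j * z) ^ m) / of_nat n) sums g z"
      unfolding g_def by (intro sums_divide sums_sum sums) (use z nw in \<open>simp add: norm_mult norm_power\<close>)
    moreover have "(\<Sum>j<n. b m * (w ^ j * z) ^ m) / of_nat n = (if n dvd m then b m else 0) * z ^ m" for m
    proof -
      have "(\<Sum>j<n. b m * (w ^ j * z) ^ m) = b m * z ^ m * (\<Sum>j<n. (w ^ m) ^ j)"
        by (simp add: sum_distrib_left power_mult_distrib power_mult[symmetric] mult_ac)
      also have "\<dots> = b m * z ^ m * (if n dvd m then of_nat n else 0)"
        unfolding wm using sum_roots_unity_power[OF n] by simp
      finally show ?thesis using n by simp
    qed
    ultimately show ?thesis by simp
  qed
  ultimately show ?thesis using that by blast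
qed

text \<open>The squares of the two sides differ by
  \<open>(1 - (norm a)\<^sup>2) * (1 - (norm w)\<^sup>2)\<close>.\<close>

lemma norm_moebius_le:
  fixes a w :: complex
  assumes "norm a \<le> 1" "norm w \<le> 1"
  shows "norm (w - a) \<le> norm (1 - cnj a * w)"
proof -
  have "of_real ((norm (1 - cnj a * w))\<^sup>2 - (norm (w - a))\<^sup>2) =
      complex_of_real ((1 - (norm a)\<^sup>2) * (1 - (norm w)\<^sup>2))"
    by (simp add: complex_norm_square del: of_real_power) (simp add: algebra_simps)
  then have "(norm (1 - cnj a * w))\<^sup>2 - (norm (w - a))\<^sup>2 = (1 - (norm a)\<^sup>2) * (1 - (norm w)\<^sup>2)"
    using of_real_eq_iff by blast
  also have "\<dots> \<ge> 0"
    using assms by (simp add: power_le_one)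
  finally show ?thesis by (simp add: power2_le_iff_abs_le)
qed

text \<open>The Moebius map sending \<open>b 0\<close> to 0, applied to the part \<open>g\<close>
  with exponents divisible by \<open>n\<close>, gives
  \<open>z ^ n * (k z / (1 - cnj (b 0) * g z))\<close>. Cancel \<open>z ^ n\<close> and evaluate at
  0, where \<open>k 0 = b n\<close> and \<open>g 0 = b 0\<close>.\<close>

lemma bounded_powser_coeff_le:
  fixes b :: "nat \<Rightarrow> complex"
  assumes sums: "\<And>z. z \<in> ball 0 1 \<Longrightarrow> (\<lambda>m. b m * z ^ m) sums f z"
    and bound: "\<And>z. z \<in> ball 0 1 \<Longrightarrow> norm (f z) \<le> 1"
    and n: "0 < n" and b0: "norm (b 0) < 1"
  shows "norm (b n) \<le> 1 - (norm (b 0))\<^sup>2"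
proof -
  obtain g where g: "\<And>z. z \<in> ball 0 1 \<Longrightarrow> (\<lambda>m. (if n dvd m then b m else 0) * z ^ m) sums g z"
    and g_le: "\<And>z. z \<in> ball 0 1 \<Longrightarrow> norm (g z) \<le> 1"
    using powser_dvd_part[OF sums bound n] by blast
  \<comment> \<open>Subtracting \<open>b 0\<close> removes index 0, and no index strictly between 0
    and \<open>n\<close> is divisible by \<open>n\<close>; hence \<open>z ^ n\<close> factors
    out.\<close>
  define c where "c m = (if n dvd m \<and> m \<noteq> 0 then b m else 0)" for m
  have c: "(\<lambda>m. c m * z ^ m) sums (g z - b 0)" if "z \<in> ball 0 1" for z
  proof -
    have "(\<lambda>m. (if n dvd m then b m else 0) * z ^ m - (if m = 0 then b 0 else 0)) sums (g z - b 0)"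
      by (intro sums_diff g that sums_single)
    moreover have "(if n dvd m then b m else 0) * z ^ m - (if m = 0 then b 0 else 0) = c m * z ^ m" for m
      by (simp add: c_def)
    ultimately show ?thesis by simp
  qed
  have "c m = 0" if "m < n" for m
    using that by (auto simp: c_def dest: dvd_imp_le)
  with c obtain k where k: "\<And>z. z \<in> ball 0 1 \<Longrightarrow> (\<lambda>m. c (m + n) * z ^ m) sums k z"
    and gk: "\<And>z. z \<in> ball 0 1 \<Longrightarrow> g z - b 0 = z ^ n * k z"
    using powser_factor[of c "\<lambda>z. g z - b 0" n] by blast
  have k0: "k 0 = b n"
    using k[of 0] n by (simp add: c_def)
  have g0: "g 0 = b 0"
    using g[of 0] by simp
  have hol: "g holomorphic_on ball 0 1" "k holomorphic_on ball 0 1"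
    using g k by (auto intro!: power_series_holomorphic)
  have nz: "1 - cnj (b 0) * g z \<noteq> 0" if "z \<in> ball 0 1" for z
  proof
    assume "1 - cnj (b 0) * g z = 0"
    then have "norm (cnj (b 0) * g z) = 1" by (metis eq_iff_diff_eq_0 norm_one)
    moreover have "norm (cnj (b 0) * g z) \<le> norm (b 0)"
      using g_le[OF that] by (simp add: norm_mult mult_left_le)
    ultimately show False using b0 by simp
  qed
  have "norm (k 0 / (1 - cnj (b 0) * g 0)) \<le> 1"
  proof (rule unit_disc_power_cancel[where n = n and q = "\<lambda>z. k z / (1 - cnj (b 0) * g z)"])
    show "(\<lambda>z. k z / (1 - cnj (b 0) * g z)) holomorphic_on ball 0 1"
      by (intro holomorphic_intros hol nz)
    show "norm (z ^ n * (k z / (1 - cnj (b 0) * g z))) \<le> 1" if "z \<in> ball 0 1" for z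
      using norm_moebius_le[of "b 0" "g z"] b0 g_le[OF that] nz[OF that] gk[OF that, symmetric]
      by (simp add: norm_divide)
  qed auto
  moreover have "1 - cnj (b 0) * b 0 = of_real (1 - (norm (b 0))\<^sup>2)"
    by (simp add: complex_norm_square mult.commute del: of_real_power)
  moreover have "(norm (b 0))\<^sup>2 < 1"
    using b0 by (simp add: abs_square_less_1)
  ultimately show ?thesis
    by (simp add: k0 g0 norm_divide del: of_real_diff)
qed

lemma normalized_bounded_coeff_le:
  fixes A :: "complex \<Rightarrow> complex"
  assumes sums: "\<And>z. z \<in> ball 0 1 \<Longrightarrow> (\<lambda>m. a m * z ^ m) sums A z"
    and a: "a 0 = 0" "a 1 = 1"
    and bound: "\<And>z. z \<in> ball 0 1 \<Longrightarrow> norm (A z) \<le> M"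
    and M: "1 < M"
  shows "norm (a (n + 2)) \<le> M - 1 / M"
proof -
  obtain k where k: "\<And>z. z \<in> ball 0 1 \<Longrightarrow> (\<lambda>m. a (m + 1) * z ^ m) sums k z"
    and Ak: "\<And>z. z \<in> ball 0 1 \<Longrightarrow> A z = z ^ 1 * k z"
    using powser_factor[OF sums, of 1] a by blast
  define b where "b m = a (m + 1) / of_real M" for m
  have b: "(\<lambda>m. b m * z ^ m) sums (k z / of_real M)" if "z \<in> ball 0 1" for z
    using sums_divide[OF k[OF that], of "of_real M"] by (simp add: b_def)
  have "norm (k z / of_real M) \<le> 1" if "z \<in> ball 0 1" for z
  proof (rule unit_disc_power_cancel[where n = 1, OF _ _ that])
    show "(\<lambda>z. k z / of_real M) holomorphic_on ball 0 1"
      using b by (auto intro!: power_series_holomorphic)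
    show "norm (z ^ 1 * (k z / of_real M)) \<le> 1" if "z \<in> ball 0 1" for z
      using bound[OF that] M unfolding Ak[OF that] by (simp add: norm_mult norm_divide)
  qed
  \<comment> \<open>Dividing by \<open>z\<close> lowers indices by one: \<open>a (n + 2)\<close>
    becomes \<open>b (n + 1)\<close>, a positive index, and \<open>b 0 = 1 / M\<close>.\<close>
  then have "norm (b (n + 1)) \<le> 1 - (norm (b 0))\<^sup>2"
    using b M a by (intro bounded_powser_coeff_le[where f = "\<lambda>z. k z / of_real M"])
      (auto simp: b_def norm_divide)
  then have "norm (a (n + 2)) / M \<le> 1 - (1 / M)\<^sup>2"
    using M a by (simp add: b_def norm_divide)
  then have "norm (a (n + 2)) \<le> (1 - (1 / M)\<^sup>2) * M"
    using M by (simp only: pos_divide_le_eq)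
  also have "\<dots> = M - 1 / M"
    using M by (simp add: field_simps power2_eq_square)
  finally show ?thesis .
qed

section \<open>Two-point estimates\<close>

text \<open>Induction step for monomials \<open>P\<close>, \<open>Q\<close> of degree
  \<open>m\<close> gaining one factor, by the product rule for differences. The extra
  \<open>r\<close> on the left avoids the exponent \<open>m - 1\<close>, so degree 0 needs no
  special treatment.\<close>

lemma norm_mult_diff_step:
  fixes P Q a b :: complex
  assumes PQ: "r * norm (P - Q) \<le> real m * r ^ m * d" and Q: "norm Q \<le> r ^ m"
    and a: "norm a \<le> r" and ab: "norm (a - b) = d"
  shows "r * norm (P * a - Q * b) \<le> real (Suc m) * r ^ Suc m * d"
proof -
  have r: "0 \<le> r" using a norm_ge_zero[of a] by linarith
  have "P * a - Q * b = (P - Q) * a + Q * (a - b)" by (simp add: algebra_simps)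
  then have "norm (P * a - Q * b) \<le> norm (P - Q) * norm a + norm Q * d"
    using norm_triangle_ineq[of "(P - Q) * a" "Q * (a - b)"] by (simp add: norm_mult ab)
  also have "\<dots> \<le> norm (P - Q) * r + r ^ m * d"
    using a Q ab by (intro add_mono mult_left_mono mult_right_mono) auto
  finally have "r * norm (P * a - Q * b) \<le> r * (norm (P - Q) * r + r ^ m * d)"
    using r by (rule mult_left_mono)
  also have "\<dots> = r * norm (P - Q) * r + r ^ Suc m * d" by (simp add: algebra_simps)
  also have "\<dots> \<le> real m * r ^ m * d * r + r ^ Suc m * d"
    by (rule add_mono[OF mult_right_mono[OF PQ r] order_refl])
  also have "\<dots> = real (Suc m) * r ^ Suc m * d" by (simp add: algebra_simps)
  finally show ?thesis .
qed

text \<open>The factors are added one at a time, first the conjugates and then the others;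
  conjugation is an isometry, so the same step serves both.\<close>

lemma norm_cnj_power_mult_diff:
  assumes z: "norm z \<le> r" and w: "norm w \<le> r"
  shows "r * norm (cnj z ^ k * z ^ n - cnj w ^ k * w ^ n) \<le> real (k + n) * r ^ (k + n) * norm (z - w)"
proof -
  have Q: "norm (cnj w ^ i * w ^ j) \<le> r ^ (i + j)" for i j
    using power_mono[OF w, of "i + j"] by (simp add: norm_mult norm_power power_add)
  have base: "r * norm (cnj z ^ k - cnj w ^ k) \<le> real k * r ^ k * norm (z - w)" for k
  proof (induction k)
    case (Suc k)
    have "norm (cnj z - cnj w) = norm (z - w)"
      by (metis complex_cnj_diff complex_mod_cnj)
    from norm_mult_diff_step[OF Suc.IH _ _ this] show ?case
      using Q[of k 0] z by (simp add: mult.commute)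
  qed simp
  show ?thesis
  proof (induction n)
    case 0
    show ?case using base[of k] by simp
  next
    case (Suc n)
    from norm_mult_diff_step[OF Suc.IH Q z refl] show ?case
      by (simp add: mult_ac)
  qed
qed

text \<open>Rests on \<open>2 - r + k * (1 - r) = 1 + (k + 1) * (1 - r)\<close>. Both resulting
  fractions are visibly increasing in \<open>r\<close>, and each is the sum of a standard
  series.\<close>

lemma dilation_weight_eq:
  fixes r :: real
  assumes "r < 1"
  shows "r ^ (k + 1) * (2 - r + real k * (1 - r)) / (1 - r)\<^sup>2 =
    r ^ (k + 1) * (1 / (1 - r)\<^sup>2 + (real k + 1) / (1 - r))"
  using assms by (simp add: divide_simps power2_eq_square) (simp add: algebra_simps)

text \<open>Writing \<open>k + n + 2\<close> as \<open>(n + 1) + (k + 1)\<close> splits the series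
  into the differentiated geometric series and the geometric series.\<close>

lemma weighted_geometric_sums:
  fixes r :: real
  assumes "0 \<le> r" "r < 1"
  shows "(\<lambda>n. real (k + (n + 2)) * r ^ (k + n + 1)) sums
    (r ^ (k + 1) * (2 - r + real k * (1 - r)) / (1 - r)\<^sup>2)"
proof -
  have "(\<lambda>n. r ^ (k + 1) * (of_nat (Suc n) * r ^ n + (real k + 1) * r ^ n)) sums
      (r ^ (k + 1) * (1 / (1 - r)\<^sup>2 + (real k + 1) * (1 / (1 - r))))"
    using assms by (intro sums_mult sums_add geometric_deriv_sums geometric_sums) auto
  moreover have "r ^ (k + 1) * (of_nat (Suc n) * r ^ n + (real k + 1) * r ^ n) =
      real (k + (n + 2)) * r ^ (k + n + 1)" for n
    by (simp add: power_add distrib_left distrib_right mult_ac)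
  ultimately show ?thesis
    by (simp only: dilation_weight_eq[OF assms(2)] times_divide_eq_right mult_1_right)
qed

lemma powser_tail_sums:
  fixes a :: "nat \<Rightarrow> complex"
  assumes sums: "\<And>z. z \<in> ball 0 1 \<Longrightarrow> (\<lambda>m. a m * z ^ m) sums A z"
    and a: "a 0 = 0" "a 1 = 1" and z: "z \<in> ball 0 1"
  shows "(\<lambda>n. a (n + 2) * (cnj z ^ k * z ^ (n + 2))) sums (cnj z ^ k * (A z - z))"
proof -
  have "(\<lambda>n. a (n + 2) * z ^ (n + 2)) sums (A z - z)"
    using sums_split_initial_segment[OF sums[OF z], of 2] a by (simp add: numeral_2_eq_2)
  from sums_mult[OF this, of "cnj z ^ k"] show ?thesis by (simp add: mult_ac)
qed

lemma powser_tail_diff_le: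
  fixes a :: "nat \<Rightarrow> complex"
  assumes sums: "\<And>z. z \<in> ball 0 1 \<Longrightarrow> (\<lambda>m. a m * z ^ m) sums A z"
    and a: "a 0 = 0" "a 1 = 1" "\<And>n. norm (a (n + 2)) \<le> C"
    and r: "0 < r" "r < 1" and z: "norm z \<le> r" and w: "norm w \<le> r"
  shows "norm (cnj z ^ k * (A z - z) - cnj w ^ k * (A w - w)) \<le>
    C * (r ^ (k + 1) * (2 - r + real k * (1 - r)) / (1 - r)\<^sup>2) * norm (z - w)"
proof (rule norm_sums_le)
  have "z \<in> ball 0 1" "w \<in> ball 0 1" using z w r by auto
  then show "(\<lambda>n. a (n + 2) * (cnj z ^ k * z ^ (n + 2)) - a (n + 2) * (cnj w ^ k * w ^ (n + 2)))
      sums (cnj z ^ k * (A z - z) - cnj w ^ k * (A w - w))"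
    by (intro sums_diff powser_tail_sums[OF sums a(1,2)])
  show "(\<lambda>n. C * (real (k + (n + 2)) * r ^ (k + n + 1)) * norm (z - w)) sums
      (C * (r ^ (k + 1) * (2 - r + real k * (1 - r)) / (1 - r)\<^sup>2) * norm (z - w))"
    using r by (intro sums_mult sums_mult2 weighted_geometric_sums) auto
  show "norm (a (n + 2) * (cnj z ^ k * z ^ (n + 2)) - a (n + 2) * (cnj w ^ k * w ^ (n + 2)))
      \<le> C * (real (k + (n + 2)) * r ^ (k + n + 1)) * norm (z - w)" for n
  proof -
    \<comment> \<open>One factor \<open>r\<close> is split off the power \<open>k + n + 2\<close>,
      to be cancelled against the left side.\<close>
    have "r * norm (cnj z ^ k * z ^ (n + 2) - cnj w ^ k * w ^ (n + 2)) \<le>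
        r * (real (k + (n + 2)) * r ^ (k + n + 1) * norm (z - w))"
      using norm_cnj_power_mult_diff[OF z w, of k "n + 2"] by (simp add: mult_ac)
    then have "norm (cnj z ^ k * z ^ (n + 2) - cnj w ^ k * w ^ (n + 2)) \<le>
        real (k + (n + 2)) * r ^ (k + n + 1) * norm (z - w)"
      using r by (simp only: mult_le_cancel_left_pos)
    then have "norm (a (n + 2)) * norm (cnj z ^ k * z ^ (n + 2) - cnj w ^ k * w ^ (n + 2)) \<le>
        C * (real (k + (n + 2)) * r ^ (k + n + 1) * norm (z - w))"
      using a(3) order_trans[OF norm_ge_zero a(3)] by (intro mult_mono) auto
    then show ?thesis
      by (simp only: norm_mult[symmetric] right_diff_distrib mult.assoc)
  qed
qed

lemma powser_tail_le:
  fixes a :: "nat \<Rightarrow> complex"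
  assumes sums: "\<And>z. z \<in> ball 0 1 \<Longrightarrow> (\<lambda>m. a m * z ^ m) sums A z"
    and a: "a 0 = 0" "a 1 = 1" "\<And>n. norm (a (n + 2)) \<le> C"
    and z: "norm z < 1"
  shows "norm (cnj z ^ k * (A z - z)) \<le> C * (norm z ^ (k + 2) / (1 - norm z))"
proof (rule norm_sums_le)
  show "(\<lambda>n. a (n + 2) * (cnj z ^ k * z ^ (n + 2))) sums (cnj z ^ k * (A z - z))"
    using z by (intro powser_tail_sums[OF sums a(1,2)]) auto
  show "(\<lambda>n. C * (norm z ^ (k + 2) * norm z ^ n)) sums (C * (norm z ^ (k + 2) / (1 - norm z)))"
    using sums_mult[OF geometric_sums[of "norm z"], of "C * norm z ^ (k + 2)"] z by (simp add: mult_ac)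
  show "norm (a (n + 2) * (cnj z ^ k * z ^ (n + 2))) \<le> C * (norm z ^ (k + 2) * norm z ^ n)" for n
    using mult_right_mono[OF a(3)[of n], of "norm z ^ (k + 2) * norm z ^ n"]
    by (simp add: norm_mult norm_power power_add mult_ac)
qed

section \<open>The root equation\<close>

lemma sum_lessThan_head:
  fixes f :: "nat \<Rightarrow> 'a::comm_monoid_add"
  assumes "0 < p"
  shows "(\<Sum>k<p. f k) = f 0 + (\<Sum>k=1..p-1. f k)"
proof -
  obtain q where q: "p = Suc q" using assms by (cases p) auto
  show ?thesis
    unfolding q sum.lessThan_Suc_shift using sum.atLeast1_atMost_eq[of f q] by simp
qed

text \<open>Bounds the Lipschitz constant of \<open>F z - z\<close> on the disk of radius \<open>r\<close>; the root equation is
  \<open>dilation p C r = 1\<close>.\<close>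

definition dilation :: "nat \<Rightarrow> (nat \<Rightarrow> real) \<Rightarrow> real \<Rightarrow> real"
  where "dilation p C r = (\<Sum>k<p. C k * (r ^ (k + 1) * (2 - r + real k * (1 - r)) / (1 - r)\<^sup>2))
    + (\<Sum>k=1..p-1. (real k + 1) * r ^ k)"

text \<open>Strictness comes from the first sum, which is nonempty with positive weights; the second
  is empty for \<open>p = 1\<close> and only needs weak monotonicity.\<close>

lemma dilation_strict_mono:
  assumes p: "0 < p" and C: "\<And>k. k < p \<Longrightarrow> 0 < C k"
    and rs: "0 \<le> r" "r < s" "s < 1"
  shows "dilation p C r < dilation p C s"
proof -
  have w: "r ^ (k + 1) * (2 - r + real k * (1 - r)) / (1 - r)\<^sup>2
      < s ^ (k + 1) * (2 - s + real k * (1 - s)) / (1 - s)\<^sup>2" for k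
  proof -
    have "r ^ (k + 1) < s ^ (k + 1)"
      using rs power_strict_mono[of r s "Suc k"] by simp
    moreover have "1 / (1 - r)\<^sup>2 \<le> 1 / (1 - s)\<^sup>2" "(real k + 1) / (1 - r) \<le> (real k + 1) / (1 - s)"
      using rs by (auto intro!: divide_left_mono power_mono mult_pos_pos)
    moreover have "0 < 1 / (1 - r)\<^sup>2 + (real k + 1) / (1 - r)"
      using rs by (intro add_pos_nonneg divide_pos_pos divide_nonneg_pos) auto
    ultimately show ?thesis
      using rs by (subst (1 2) dilation_weight_eq) (simp_all only: mult_less_le_imp_less add_mono zero_le_power)
  qed
  have "(\<Sum>k<p. C k * (r ^ (k + 1) * (2 - r + real k * (1 - r)) / (1 - r)\<^sup>2))
      < (\<Sum>k<p. C k * (s ^ (k + 1) * (2 - s + real k * (1 - s)) / (1 - s)\<^sup>2))"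
    using p by (intro sum_strict_mono mult_strict_left_mono w C) (auto simp: lessThan_empty_iff)
  moreover have "(\<Sum>k=1..p-1. (real k + 1) * r ^ k) \<le> (\<Sum>k=1..p-1. (real k + 1) * s ^ k)"
    using rs by (intro sum_mono mult_left_mono power_mono) auto
  ultimately show ?thesis by (simp add: dilation_def)
qed

lemma dilation_root:
  assumes p: "0 < p" and C: "\<And>k. k < p \<Longrightarrow> 0 < C k"
  obtains \<rho> where "0 < \<rho>" "\<rho> < 1" "dilation p C \<rho> = 1"
proof -
  have d0: "dilation p C 0 = 0"
    by (auto simp: dilation_def intro!: sum.neutral)
  have C0: "0 < C 0" using C p by blast
  \<comment> \<open>Chosen so that \<open>C 0 * (1 / t - 1) = 1\<close>. At radius
    \<open>1 - t\<close> the weight for \<open>k = 0\<close> is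
    \<open>(1 - t) * (1 + t) / t\<^sup>2 = 1 / t\<^sup>2 - 1\<close>, which is at least
    \<open>1 / t - 1\<close>; so this term alone reaches 1.\<close>
  define t where "t = C 0 / (1 + C 0)"
  have t: "0 < t" "t < 1" using C0 by (auto simp: t_def)
  have "1 = C 0 * (1 / t - 1)" using C0 by (simp add: t_def field_simps)
  also have "\<dots> \<le> C 0 * (1 / t\<^sup>2 - 1)"
    using C0 t by (intro mult_left_mono diff_right_mono divide_left_mono)
      (auto simp: power2_eq_square mult_left_le)
  also have "\<dots> = C 0 * ((1 - t) ^ (0 + 1) * (2 - (1 - t) + real 0 * (1 - (1 - t))) / (1 - (1 - t))\<^sup>2)"
    using t by (simp add: field_simps power2_eq_square)
  also have "\<dots> \<le> dilation p C (1 - t)"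
  proof -
    have "C 0 * ((1 - t) ^ (0 + 1) * (2 - (1 - t) + real 0 * (1 - (1 - t))) / (1 - (1 - t))\<^sup>2)
        \<le> (\<Sum>k<p. C k * ((1 - t) ^ (k + 1) * (2 - (1 - t) + real k * (1 - (1 - t))) / (1 - (1 - t))\<^sup>2))"
      using p t C by (intro member_le_sum) (auto intro!: mult_nonneg_nonneg divide_nonneg_nonneg less_imp_le[OF C])
    moreover have "0 \<le> (\<Sum>k=1..p-1. (real k + 1) * (1 - t) ^ k)"
      using t by (intro sum_nonneg) auto
    ultimately show ?thesis unfolding dilation_def by linarith
  qed
  finally have d1: "1 \<le> dilation p C (1 - t)" .
  have "continuous_on {0..1 - t} (dilation p C)"
    unfolding dilation_def using t by (intro continuous_intros) auto
  then obtain \<rho> where \<rho>: "0 \<le> \<rho>" "\<rho> \<le> 1 - t" "dilation p C \<rho> = 1"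
    using IVT'[of "dilation p C" 0 1 "1 - t"] d0 d1 t by auto
  moreover have "\<rho> \<noteq> 0" using \<rho> d0 by auto
  ultimately show ?thesis using that[of \<rho>] t by simp
qed

text \<open>The radius is the integral of \<open>1 - dilation\<close> from 0 to its root; termwise, positivity is
  \<open>\<rho>\<^sup>m \<le> m * \<rho>\<^sup>m\<close>.\<close>

lemma schlicht_radius_pos:
  fixes \<rho> :: real
  assumes p: "0 < p" and C: "\<And>k. k < p \<Longrightarrow> 0 < C k"
    and \<rho>: "0 < \<rho>" "\<rho> < 1" "dilation p C \<rho> = 1"
  shows "0 < \<rho> - (\<Sum>k=1..p-1. \<rho> ^ (k + 1)) - (\<Sum>k<p. C k * (\<rho> ^ (k + 2) / (1 - \<rho>)))"
proof -
  have w: "\<rho> ^ (k + 2) / (1 - \<rho>) < \<rho> * (\<rho> ^ (k + 1) * (2 - \<rho> + real k * (1 - \<rho>)) / (1 - \<rho>)\<^sup>2)" for k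
  proof -
    have "1 / (1 - \<rho>) \<le> (real k + 1) / (1 - \<rho>)" "0 < 1 / (1 - \<rho>)\<^sup>2"
      using \<rho> by (auto intro: divide_right_mono)
    then have "1 / (1 - \<rho>) < 1 / (1 - \<rho>)\<^sup>2 + (real k + 1) / (1 - \<rho>)"
      by linarith
    then have "\<rho> ^ (k + 2) * (1 / (1 - \<rho>)) < \<rho> ^ (k + 2) * (1 / (1 - \<rho>)\<^sup>2 + (real k + 1) / (1 - \<rho>))"
      using \<rho> by (intro mult_strict_left_mono) auto
    then show ?thesis
      using \<rho> by (subst dilation_weight_eq) (auto simp: mult_ac)
  qed
  have "(\<Sum>k<p. C k * (\<rho> ^ (k + 2) / (1 - \<rho>)))
      < (\<Sum>k<p. C k * (\<rho> * (\<rho> ^ (k + 1) * (2 - \<rho> + real k * (1 - \<rho>)) / (1 - \<rho>)\<^sup>2)))"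
    using p by (intro sum_strict_mono mult_strict_left_mono w C) (auto simp: lessThan_empty_iff)
  moreover have "(\<Sum>k=1..p-1. \<rho> ^ (k + 1)) \<le> (\<Sum>k=1..p-1. \<rho> * ((real k + 1) * \<rho> ^ k))"
    using \<rho> by (intro sum_mono) (auto simp: algebra_simps)
  \<comment> \<open>The root equation spreads the leading \<open>\<rho>\<close> over the terms of
    the two sums, where the comparisons above apply.\<close>
  moreover have "\<rho> = \<rho> * dilation p C \<rho>" using \<rho> by simp
  ultimately show ?thesis
    unfolding dilation_def by (simp add: sum_distrib_left algebra_simps)
qed

section \<open>Schlicht disks\<close>

text \<open>By invariance of domain the image of the open disk is open; since the image of its boundary
  avoids the target disk, it is also relatively closed there.\<close>

lemma schlicht_disk_in_ball:
  assumes cont: "continuous_on (cball 0 \<rho>) F" and inj: "inj_on F (ball 0 \<rho>)"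
    and F0: "F 0 = 0" and \<rho>: "0 < \<rho>" and \<sigma>: "0 < \<sigma>"
    and bd: "\<And>z. norm z = \<rho> \<Longrightarrow> \<sigma> \<le> norm (F z)"
  shows "schlicht_disk_in F (ball 0 \<rho>) 0 \<sigma>"
proof -
  have contb: "continuous_on (ball 0 \<rho>) F"
    using cont by (rule continuous_on_subset) auto
  have opF: "open (F ` ball 0 \<rho>)"
    by (rule Further_Topology.invariance_of_domain[OF contb _ inj]) simp
  have eq: "ball 0 \<sigma> \<inter> F ` ball 0 \<rho> = ball 0 \<sigma> \<inter> F ` cball 0 \<rho>"
    using bd by (force simp: image_iff less_le)
  have "closed (F ` cball 0 \<rho>)"
    by (intro compact_imp_closed compact_continuous_image cont) simp
  then have "closedin (top_of_set (ball 0 \<sigma>)) (ball 0 \<sigma> \<inter> F ` ball 0 \<rho>)"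
    unfolding eq by (rule closedin_closed_Int)
  moreover have "openin (top_of_set (ball 0 \<sigma>)) (ball 0 \<sigma> \<inter> F ` ball 0 \<rho>)"
    using opF by (rule openin_open_Int)
  moreover have "0 \<in> ball 0 \<sigma> \<inter> F ` ball 0 \<rho>"
    using \<rho> \<sigma> F0 by (auto intro!: image_eqI[of _ _ 0])
  ultimately have "ball 0 \<sigma> \<inter> F ` ball 0 \<rho> = ball 0 \<sigma>"
    using connected_ball[of "0::complex" \<sigma>] unfolding connected_clopen by blast
  then have sub: "ball 0 \<sigma> \<subseteq> F ` ball 0 \<rho>" by blast
  obtain g where g: "homeomorphism (ball 0 \<rho>) (F ` ball 0 \<rho>) F g"
    using Further_Topology.invariance_of_domain_homeomorphism[OF _ contb _ inj] by auto
  define \<Omega> where "\<Omega> = ball 0 \<rho> \<inter> F -` ball 0 \<sigma>"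
  have im: "F ` \<Omega> = ball 0 \<sigma>" using sub by (auto simp: \<Omega>_def)
  \<comment> \<open>As the image of a disk under the continuous inverse, the preimage is
    connected.\<close>
  have "\<Omega> = g ` ball 0 \<sigma>"
    using g sub unfolding \<Omega>_def homeomorphism_def by (force simp: image_iff)
  then have "connected \<Omega>"
    using g sub by (auto intro!: connected_continuous_image continuous_on_subset[of "F ` ball 0 \<rho>" g]
        simp: homeomorphism_def)
  moreover have "open \<Omega>"
    unfolding \<Omega>_def by (rule continuous_open_preimage[OF contb]) auto
  moreover have "\<Omega> \<subseteq> ball 0 \<rho>" "inj_on F \<Omega>"
    using inj by (auto simp: \<Omega>_def inj_on_def)
  ultimately show ?thesis
    using im \<sigma> unfolding schlicht_disk_in_def by blast
qed

section \<open>Univalence of poly-analytic functions\<close>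

text \<open>Replacing every \<open>A k z\<close> by \<open>z\<close> leaves the error
  \<open>T\<close>; of the remaining sum, \<open>k = 0\<close> gives \<open>z - w\<close> and the
  rest is \<open>S\<close>. The Lipschitz bounds of \<open>S\<close> and \<open>T\<close> add up to
  \<open>dilation p C r\<close>.\<close>

lemma norm_cnj_sum_diff_ge:
  fixes A :: "nat \<Rightarrow> complex \<Rightarrow> complex"
  assumes p: "0 < p"
    and F: "\<And>z. z \<in> ball 0 1 \<Longrightarrow> F z = (\<Sum>k<p. cnj z ^ k * A k z)"
    and sums: "\<And>k z. k < p \<Longrightarrow> z \<in> ball 0 1 \<Longrightarrow> (\<lambda>m. a k m * z ^ m) sums A k z"
    and a: "\<And>k. k < p \<Longrightarrow> a k 0 = 0" "\<And>k. k < p \<Longrightarrow> a k 1 = 1"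
    and C: "\<And>k n. k < p \<Longrightarrow> norm (a k (n + 2)) \<le> C k"
    and r: "0 < r" "r < 1" and z: "norm z \<le> r" and w: "norm w \<le> r"
  shows "(1 - dilation p C r) * norm (z - w) \<le> norm (F z - F w)"
proof -
  define S where "S = (\<Sum>k=1..p-1. cnj z ^ k * z - cnj w ^ k * w)"
  define T where "T = (\<Sum>k<p. cnj z ^ k * (A k z - z) - cnj w ^ k * (A k w - w))"
  have zw: "z \<in> ball 0 1" "w \<in> ball 0 1" using z w r by auto
  have "F z - F w = (\<Sum>k<p. cnj z ^ k * z - cnj w ^ k * w) + T"
    unfolding F[OF zw(1)] F[OF zw(2)] T_def sum_subtractf[symmetric] sum.distrib[symmetric]
    by (intro sum.cong) (auto simp: algebra_simps)
  then have "z - w = (F z - F w) - (S + T)"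
    using sum_lessThan_head[OF p, of "\<lambda>k. cnj z ^ k * z - cnj w ^ k * w"] by (simp add: S_def)
  then have "norm (z - w) \<le> norm (F z - F w) + (norm S + norm T)"
    by (metis norm_triangle_ineq4 norm_triangle_ineq add_left_mono order_trans)
  moreover have "norm T \<le>
      (\<Sum>k<p. C k * (r ^ (k + 1) * (2 - r + real k * (1 - r)) / (1 - r)\<^sup>2) * norm (z - w))"
    unfolding T_def by (intro sum_norm_le powser_tail_diff_le[OF sums a C r z w]) auto
  moreover have "norm S \<le> (\<Sum>k=1..p-1. (real k + 1) * r ^ k * norm (z - w))"
    unfolding S_def
  proof (intro sum_norm_le)
    fix k
    have "r * norm (cnj z ^ k * z - cnj w ^ k * w) \<le> r * ((real k + 1) * r ^ k * norm (z - w))"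
      using norm_cnj_power_mult_diff[OF z w, of k 1] by (simp add: mult_ac add_ac)
    then show "norm (cnj z ^ k * z - cnj w ^ k * w) \<le> (real k + 1) * r ^ k * norm (z - w)"
      using r by (simp only: mult_le_cancel_left_pos)
  qed
  ultimately show ?thesis
    by (simp add: dilation_def algebra_simps sum_distrib_left sum_distrib_right)
qed

text \<open>The two-point estimate with \<open>w = 0\<close> degenerates to a zero lower bound at
  the root radius. Estimating moduli directly drops the degree factors and leaves a positive bound
  there.\<close>

lemma norm_cnj_sum_ge:
  fixes A :: "nat \<Rightarrow> complex \<Rightarrow> complex"
  assumes p: "0 < p"
    and F: "\<And>z. z \<in> ball 0 1 \<Longrightarrow> F z = (\<Sum>k<p. cnj z ^ k * A k z)"
    and sums: "\<And>k z. k < p \<Longrightarrow> z \<in> ball 0 1 \<Longrightarrow> (\<lambda>m. a k m * z ^ m) sums A k z"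
    and a: "\<And>k. k < p \<Longrightarrow> a k 0 = 0" "\<And>k. k < p \<Longrightarrow> a k 1 = 1"
    and C: "\<And>k n. k < p \<Longrightarrow> norm (a k (n + 2)) \<le> C k"
    and z: "norm z < 1"
  shows "norm z - (\<Sum>k=1..p-1. norm z ^ (k + 1)) - (\<Sum>k<p. C k * (norm z ^ (k + 2) / (1 - norm z)))
    \<le> norm (F z)"
proof -
  define S where "S = (\<Sum>k=1..p-1. cnj z ^ k * z)"
  define T where "T = (\<Sum>k<p. cnj z ^ k * (A k z - z))"
  have "F z = (\<Sum>k<p. cnj z ^ k * z) + T"
    using z by (simp add: F T_def sum.distrib[symmetric] algebra_simps)
  then have "z = F z - (S + T)"
    using sum_lessThan_head[OF p, of "\<lambda>k. cnj z ^ k * z"] by (simp add: S_def)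
  then have "norm z \<le> norm (F z) + (norm S + norm T)"
    by (metis norm_triangle_ineq4 norm_triangle_ineq add_left_mono order_trans)
  moreover have "norm T \<le> (\<Sum>k<p. C k * (norm z ^ (k + 2) / (1 - norm z)))"
    unfolding T_def by (intro sum_norm_le powser_tail_le[OF sums a C z]) auto
  moreover have "norm S \<le> (\<Sum>k=1..p-1. norm z ^ (k + 1))"
    unfolding S_def by (intro sum_norm_le) (simp add: norm_mult norm_power)
  ultimately show ?thesis by linarith
qed

theorem theorem3:
  fixes p :: nat and M :: "nat \<Rightarrow> real"
    and A :: "nat \<Rightarrow> complex \<Rightarrow> complex" and F :: "complex \<Rightarrow> complex"
  assumes "0 < p"
    and "\<And>k. k < p \<Longrightarrow> 1 < M k"
    and "poly_analytic_on p F (ball 0 1)"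
    and "\<And>z. z \<in> ball 0 1 \<Longrightarrow> F z = (\<Sum>k<p. cnj z ^ k * A k z)"
    and "\<And>k. k < p \<Longrightarrow> A k holomorphic_on ball 0 1"
    and "\<And>k. k < p \<Longrightarrow> A k 0 = 0"
    and "\<And>k. k < p \<Longrightarrow> deriv (A k) 0 = 1"
    and "\<And>k z. k < p \<Longrightarrow> z \<in> ball 0 1 \<Longrightarrow> norm (A k z) \<le> M k"
  shows "\<exists>\<rho> \<sigma>.
    (\<forall>r::real. (0 < r \<and> r < 1 \<and>
        1 - (\<Sum>k<p. (M k - 1 / M k) *
                (r ^ (k + 1) * (2 - r + real k * (1 - r)) / (1 - r)\<^sup>2))
          - (\<Sum>k=1..p-1. (real k + 1) * r ^ k) = 0) \<longleftrightarrow> r = \<rho>) \<and>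
    \<sigma> = \<rho> - \<rho>\<^sup>2 * ((1 - \<rho> ^ (p - 1)) / (1 - \<rho>))
          - (\<Sum>k<p. (M k - 1 / M k) * (\<rho> ^ (k + 2) / (1 - \<rho>))) \<and>
    inj_on F (ball 0 \<rho>) \<and>
    schlicht_disk_in F (ball 0 \<rho>) 0 \<sigma>"
proof -
  define C where "C k = M k - 1 / M k" for k
  define a where "a k m = (deriv ^^ m) (A k) 0 / fact m" for k m
  have C: "0 < C k" if "k < p" for k
    using assms(2)[OF that] by (simp add: C_def field_simps) (smt (verit) mult_less_cancel_left2)
  have sums: "(\<lambda>m. a k m * z ^ m) sums A k z" if "k < p" "z \<in> ball 0 1" for k z
    using holomorphic_power_series[OF assms(5)[OF that(1)] that(2)] by (simp add: a_def)
  have a0: "a k 0 = 0" and a1: "a k 1 = 1" if "k < p" for k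
    using assms(6,7)[OF that] by (simp_all add: a_def)
  have aC: "norm (a k (n + 2)) \<le> C k" if "k < p" for k n
    unfolding C_def
    by (rule normalized_bounded_coeff_le[OF sums a0 a1 assms(8,2)]) (use that in auto)
  obtain \<rho> where \<rho>: "0 < \<rho>" "\<rho> < 1" "dilation p C \<rho> = 1"
    using dilation_root[of p C, OF assms(1) C] by blast
  have mono: "dilation p C r < dilation p C s" if "0 \<le> r" "r < s" "s < 1" for r s
    using assms(1) C that by (rule dilation_strict_mono)
  define \<sigma> where "\<sigma> = \<rho> - (\<Sum>k=1..p-1. \<rho> ^ (k + 1)) - (\<Sum>k<p. C k * (\<rho> ^ (k + 2) / (1 - \<rho>)))"
  \<comment> \<open>Closed form of the geometric sum; for \<open>p = 1\<close> both sides
    vanish.\<close>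
  have "(\<Sum>k=1..p-1. \<rho> ^ (k + 1)) = \<rho>\<^sup>2 * (\<Sum>k<p-1. \<rho> ^ k)"
    using sum.atLeast1_atMost_eq[of "\<lambda>k. \<rho> ^ (k + 1)" "p - 1"]
    by (simp add: sum_distrib_left power2_eq_square mult_ac)
  also have "\<dots> = \<rho>\<^sup>2 * ((1 - \<rho> ^ (p - 1)) / (1 - \<rho>))"
    using \<rho> by (simp add: sum_gp_strict)
  finally have \<sigma>_eq: "\<sigma> = \<rho> - \<rho>\<^sup>2 * ((1 - \<rho> ^ (p - 1)) / (1 - \<rho>))
      - (\<Sum>k<p. C k * (\<rho> ^ (k + 2) / (1 - \<rho>)))"
    by (simp add: \<sigma>_def)
  have root: "0 < r \<and> r < 1 \<and> dilation p C r = 1 \<longleftrightarrow> r = \<rho>" for r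
    using \<rho> mono[of r \<rho>] mono[of \<rho> r] by (cases r \<rho> rule: linorder_cases) auto
  have inj: "inj_on F (ball 0 \<rho>)"
  proof (rule inj_onI, rule ccontr)
    fix z w assume zw: "z \<in> ball 0 \<rho>" "w \<in> ball 0 \<rho>" "F z = F w" "z \<noteq> w"
    \<comment> \<open>Two points of the open disk lie in a closed disk of radius strictly below
      \<open>\<rho>\<close>, where the dilation is below 1.\<close>
    define r where "r = max (norm z) (norm w)"
    have r: "0 < r" "r < \<rho>" "norm z \<le> r" "norm w \<le> r"
      using zw by (auto simp: r_def less_max_iff_disj)
    have "(1 - dilation p C r) * norm (z - w) \<le> norm (F z - F w)"
      using r \<rho> by (intro norm_cnj_sum_diff_ge[OF assms(1,4) sums a0 a1 aC]) auto
    moreover have "0 < (1 - dilation p C r) * norm (z - w)"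
      using mono[of r \<rho>] r \<rho> zw by simp
    ultimately show False using zw by simp
  qed
  have "schlicht_disk_in F (ball 0 \<rho>) 0 \<sigma>"
  proof (rule schlicht_disk_in_ball[OF _ inj])
    show "continuous_on (cball 0 \<rho>) F"
      using assms(3) \<rho> unfolding poly_analytic_on_def by (auto intro: continuous_on_subset)
    show "F 0 = 0" using assms(4)[of 0] assms(6) by simp
    show "0 < \<sigma>" unfolding \<sigma>_def by (rule schlicht_radius_pos[OF assms(1) C \<rho>])
    show "\<sigma> \<le> norm (F z)" if "norm z = \<rho>" for z
      using norm_cnj_sum_ge[OF assms(1,4) sums a0 a1 aC, of z] that \<rho> by (simp add: \<sigma>_def)
  qed (use \<rho> in auto)
  moreover have "1 - x - y = 0 \<longleftrightarrow> x + y = 1" for x y :: real by linarith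
  ultimately show ?thesis
    using root \<sigma>_eq inj unfolding dilation_def C_def by (intro exI[of _ \<rho>] exI[of _ \<sigma>]) simp
qed

end
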